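(* Let $A=A_1\times\cdots\times A_n$. A language $L\subseteq A^{\omega}$ is strategical if and only if it is closed in the metric space $(A^{\omega},d)$.
   Context: $A_i$ is the set of actions of player $i$ ($1\le i\le n$) and $A=A_1\times\cdots\times A_n$ is the alphabet of moves. $A^*$ is the set of finite words on $A$ (including the empty word $\epsilon$) and $A^{\omega}$ the set of infinite words $h=h_0h_1h_2\cdots$ on $A$. A (nondeterministic) strategy for player $i$ is a relation $\sigma_i$ from $A^*$ to $A_i$, i.e. it assigns to each $w\in A^*$ a (possibly empty) subset $\sigma_i(w)\subseteq A_i$. A strategy vector on $A$ is a relation $\sigma=(\sigma_1,\dots,\sigma_n)$ from $A^*$ to $A$ of the form $(a_1,\dots,a_n)\in\sigma(w)\iff a_i\in\sigma_i(w)$ for all $1\le i\le n$. $\Sigma$ is the set of all strategy vectors on $A$, and $$\gamma(\sigma)=\{h\in A^{\omega}\mid h_0\in\sigma(\epsilon)\text{ and }h_{t+1}\in\sigma(h_0\cdots h_t)\ \forall t\ge 0\}.$$ A language $L\subseteq A^{\omega}$ is strategical if $L=\gamma(\sigma)$ for some $\sigma\in\Sigma$. The distance on $A^{\omega}$ is $d(x,y)=(1+\max\{|w|\mid w\in \mathrm{Pref}(x)\cap \mathrm{Pref}(y)\})^{-1}$, where $\mathrm{Pref}(x)\subseteq A^*$ is the set of finite prefixes of $x$ and $|w|$ is the length of $w$, with the convention $1/\infty=0$ (so $d(x,x)=0$). *)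

theory Defs
  imports "HOL-Analysis.Abstract_Metric_Spaces" "HOL-Library.Stream" "HOL-Library.Extended_Nat"
    "HOL-Library.FuncSet"
begin

text \<open>
  The players are \<open>1, \<dots>, n\<close> and \<open>Act i\<close> is the action set of player \<open>i\<close>. A move is an
  extensional function on \<open>{1..n}\<close>; the finite words over an alphabet \<open>A\<close> are \<open>lists A\<close> and
  the infinite ones are \<open>streams A\<close>.
\<close>

definition moves :: "nat \<Rightarrow> (nat \<Rightarrow> 'a set) \<Rightarrow> (nat \<Rightarrow> 'a) set" where
  "moves n Act = (\<Pi>\<^sub>E i\<in>{1..n}. Act i)"

text \<open>
  A strategy is a relation, so that \<open>\<sigma>\<^sub>i(w)\<close> is the relational image \<open>s `` {w}\<close>; it may be empty.
\<close>

definition strategies ::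
  "nat \<Rightarrow> (nat \<Rightarrow> 'a set) \<Rightarrow> nat \<Rightarrow> ((nat \<Rightarrow> 'a) list \<times> 'a) set set" where
  "strategies n Act i = {s. s \<subseteq> lists (moves n Act) \<times> Act i}"

definition strategy_vectors ::
  "nat \<Rightarrow> (nat \<Rightarrow> 'a set) \<Rightarrow> ((nat \<Rightarrow> 'a) list \<times> (nat \<Rightarrow> 'a)) set set" where
  "strategy_vectors n Act =
     {\<sigma>. \<sigma> \<subseteq> lists (moves n Act) \<times> moves n Act \<and>
         (\<exists>s. (\<forall>i\<in>{1..n}. s i \<in> strategies n Act i) \<and>
              (\<forall>w\<in>lists (moves n Act). \<forall>a\<in>moves n Act.
                 a \<in> \<sigma> `` {w} \<longleftrightarrow> (\<forall>i\<in>{1..n}. a i \<in> s i `` {w})))}"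

definition outcomes :: "'m set \<Rightarrow> ('m list \<times> 'm) set \<Rightarrow> 'm stream set" where
  "outcomes A \<sigma> =
     {h \<in> streams A. h !! 0 \<in> \<sigma> `` {[]} \<and> (\<forall>t. h !! Suc t \<in> \<sigma> `` {stake (Suc t) h})}"

definition strategical :: "nat \<Rightarrow> (nat \<Rightarrow> 'a set) \<Rightarrow> (nat \<Rightarrow> 'a) stream set \<Rightarrow> bool" where
  "strategical n Act L \<longleftrightarrow> (\<exists>\<sigma>\<in>strategy_vectors n Act. L = outcomes (moves n Act) \<sigma>)"

definition Pref :: "'m stream \<Rightarrow> 'm list set" where
  "Pref x = range (\<lambda>k. stake k x)"

text \<open>
  The supremum in \<^typ>\<open>enat\<close> is the maximum of the lengths if there are finitely many common
  prefixes, and \<open>\<infinity>\<close> otherwise.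
\<close>

definition word_dist :: "'m stream \<Rightarrow> 'm stream \<Rightarrow> real" where
  "word_dist x y =
     (case (SUP w\<in>Pref x \<inter> Pref y. enat (length w)) of
        enat k \<Rightarrow> inverse (1 + real k)
      | \<infinity> \<Rightarrow> 0)"

lemma Pref_Int: "Pref x \<inter> Pref y = {stake k x | k. stake k x = stake k y}"
proof -
  have eq: "stake k x = stake k y" if "stake k x = stake j y" for k j
    proof -
    have "k = j" using arg_cong[OF that, of length] by simp
    with that show ?thesis by simp
  qed
  show ?thesis
  proof (intro set_eqI iffI)
    fix w assume "w \<in> Pref x \<inter> Pref y"
    then obtain k j where "w = stake k x" "w = stake j y" unfolding Pref_def by blast
    with eq[of k j] have "w = stake k x \<and> stake k x = stake k y" by simp
    then show "w \<in> {stake k x | k. stake k x = stake k y}" by blast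
  next
    fix w assume "w \<in> {stake k x | k. stake k x = stake k y}"
    then obtain k where "w = stake k x \<and> stake k x = stake k y" unfolding mem_Collect_eq ..
    then have "w = stake k x" "w = stake k y" by simp_all
    then show "w \<in> Pref x \<inter> Pref y" unfolding Pref_def by blast
  qed
qed

lemma word_dist_le_iff: "word_dist x y \<le> inverse (1 + real k) \<longleftrightarrow> stake k x = stake k y"
proof -
  let ?S = "SUP w\<in>Pref x \<inter> Pref y. enat (length w)"
  have down: "stake j x = stake j y" if "stake m x = stake m y" "j \<le> m" for j m
    using that by (metis min.absorb1 take_stake)
  have S: "enat k \<le> ?S \<longleftrightarrow> stake k x = stake k y"
  proof
    assume "stake k x = stake k y"
    then have "stake k x \<in> Pref x \<inter> Pref y" unfolding Pref_Int by blast
    then show "enat k \<le> ?S" by (metis (no_types, lifting) SUP_upper length_stake)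
  next
    assume le: "enat k \<le> ?S"
    show "stake k x = stake k y"
    proof (cases k)
      case 0
      then show ?thesis by simp
    next
      case (Suc j)
      then have "enat j < ?S" using le by (metis enat_ord_simps(2) lessI less_le_trans)
      then obtain w where "w \<in> Pref x \<inter> Pref y" "enat j < enat (length w)"
        by (auto simp: less_SUP_iff)
      then obtain m where "stake m x = stake m y" "j < m" by (auto simp: Pref_Int)
      with down[of m k] Suc show ?thesis by (simp del: stake.simps)
    qed
  qed
  show ?thesis
    unfolding word_dist_def S[symmetric] by (cases ?S) (auto simp: field_simps)
qed

lemma word_dist_cases: "word_dist x y = 0 \<or> (\<exists>k. word_dist x y = inverse (1 + real k))"
  unfolding word_dist_def by (auto split: enat.split)

lemma word_dist_nonneg: "0 \<le> word_dist x y"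
  using word_dist_cases[of x y] by auto

lemma word_dist_eq_0_iff: "word_dist x y = 0 \<longleftrightarrow> x = y"
proof
  assume "word_dist x y = 0"
  then have "stake k x = stake k y" for k
    by (simp flip: word_dist_le_iff)
  then have "x !! k = y !! k" for k
    by (metis lessI stake_nth)
  then show "x = y"
    by (metis ext stream_smap_nats)
next
  assume "x = y"
  then have le: "word_dist x y \<le> inverse (1 + real k)" for k
    by (simp add: word_dist_le_iff)
  have "word_dist x y \<noteq> inverse (1 + real k)" for k
  proof
    assume "word_dist x y = inverse (1 + real k)"
    then have "inverse (1 + real k) \<le> inverse (1 + real (Suc k))" using le[of "Suc k"] by simp
    then have "1 + real (Suc k) \<le> 1 + real k" by (rule inverse_le_imp_le) simp
    then show False by simp
  qed
  then show "word_dist x y = 0"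
    using word_dist_cases by blast
qed

lemma Metric_space_word_dist: "Metric_space (streams A) word_dist"
proof
  fix x y z :: "'a stream"
  show "0 \<le> word_dist x y" by (rule word_dist_nonneg)
  show "word_dist x y = word_dist y x" by (simp add: word_dist_def Int_commute)
  show "word_dist x y = 0 \<longleftrightarrow> x = y" by (rule word_dist_eq_0_iff)
  have ultra: "word_dist x z \<le> max (word_dist x y) (word_dist y z)"
  proof (cases "max (word_dist x y) (word_dist y z) = 0")
    case True
    then show ?thesis
      by (metis max.cobounded1 max.cobounded2 order_antisym word_dist_eq_0_iff word_dist_nonneg)
  next
    case False
    then obtain k where k: "max (word_dist x y) (word_dist y z) = inverse (1 + real k)"
      using word_dist_cases[of x y] word_dist_cases[of y z] unfolding max_def by metis
    then have "stake k x = stake k y" "stake k y = stake k z"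
      by (metis max.cobounded1 word_dist_le_iff) (metis k max.cobounded2 word_dist_le_iff)
    then show ?thesis unfolding k by (simp add: word_dist_le_iff)
  qed
  then show "word_dist x z \<le> word_dist x y + word_dist y z"
    using word_dist_nonneg[of x y] word_dist_nonneg[of y z] by linarith
qed

end

(* A strategy may be empty at a word, so the play can simply be aborted there. For closed L,
   allow every move after a prefix of a word of L and no move after any other word; since the
   full set of moves and (for n >= 1) the empty set are both products, this is a strategy
   vector, and its outcomes are the words all of whose prefixes are prefixes of words of L,
   i.e. the closure of L. *)
theory Submission
  imports Defs
begin

lemma stake_in_Pref_iff: "stake k x \<in> Pref y \<longleftrightarrow> stake k x = stake k y"
proof
  assume "stake k x \<in> Pref y"
  then obtain j where j: "stake k x = stake j y"
    unfolding Pref_def by (rule rangeE)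
  have "k = j"
    using arg_cong[OF j, of length] by simp
  with j show "stake k x = stake k y"
    by simp
next
  assume "stake k x = stake k y"
  then show "stake k x \<in> Pref y"
    unfolding Pref_def by (rule range_eqI)
qed

text \<open>Lying within distance 1/(1+k) of a word means sharing its first \<open>k\<close>
  letters, so a point has a ball missing \<open>L\<close> exactly when one of its prefixes is a
  prefix of no word of \<open>L\<close>.\<close>

lemma closedin_word_dist_iff:
  assumes "L \<subseteq> streams A"
  shows "closedin (Metric_space.mtopology (streams A) word_dist) L \<longleftrightarrow>
    (\<forall>x\<in>streams A. (\<forall>k. stake k x \<in> \<Union> (Pref ` L)) \<longrightarrow> x \<in> L)"
proof -
  interpret Metric_space "streams A" word_dist
    by (rule Metric_space_word_dist)
  have prefix: "stake k x \<in> \<Union> (Pref ` L) \<longleftrightarrow> (\<exists>y\<in>L. word_dist x y \<le> inverse (1 + real k))" for k x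
    by (simp add: stake_in_Pref_iff word_dist_le_iff)
  have isolated: "(\<exists>r>0. disjnt L (mball x r)) \<longleftrightarrow> (\<exists>k. stake k x \<notin> \<Union> (Pref ` L))"
    if x: "x \<in> streams A" for x
  proof
    assume "\<exists>r>0. disjnt L (mball x r)"
    then obtain r where r: "0 < r" "disjnt L (mball x r)"
      by blast
    \<comment> \<open>Prefixes describe balls with non-strict radius, \<open>mball\<close> is
      strict; the strict inequality here puts the former inside the latter.\<close>
    obtain k where k: "inverse (real (Suc k)) < r"
      using reals_Archimedean[OF \<open>0 < r\<close>] by blast
    have "\<not> word_dist x y \<le> inverse (1 + real k)" if "y \<in> L" for y
    proof
      assume "word_dist x y \<le> inverse (1 + real k)"
      then have "y \<in> mball x r"
        using k x that assms by auto
      then show False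
        using r that by (auto simp: disjnt_iff)
    qed
    then show "\<exists>k. stake k x \<notin> \<Union> (Pref ` L)"
      unfolding prefix by blast
  next
    assume "\<exists>k. stake k x \<notin> \<Union> (Pref ` L)"
    then obtain k where "\<forall>y\<in>L. \<not> word_dist x y \<le> inverse (1 + real k)"
      unfolding prefix by blast
    then have "disjnt L (mball x (inverse (1 + real k)))"
      by (force simp: disjnt_iff)
    moreover have "0 < inverse (1 + real k)"
      by simp
    ultimately show "\<exists>r>0. disjnt L (mball x r)"
      by blast
  qed
  show ?thesis
    unfolding closedin_metric using assms isolated by blast
qed

text \<open>Since \<open>stake 0 h\<close> is the empty word, the condition on the first move is the
  case \<open>t = 0\<close> of the condition on all later ones.\<close>

lemma outcomes_iff:
  "h \<in> outcomes A \<sigma> \<longleftrightarrow> h \<in> streams A \<and> (\<forall>t. (stake t h, h !! t) \<in> \<sigma>)"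
proof -
  have "(\<forall>t. (stake t h, h !! t) \<in> \<sigma>) \<longleftrightarrow>
      ([], h !! 0) \<in> \<sigma> \<and> (\<forall>t. (stake (Suc t) h, h !! Suc t) \<in> \<sigma>)"
    proof (intro iffI allI)
    fix t assume "([], h !! 0) \<in> \<sigma> \<and> (\<forall>t. (stake (Suc t) h, h !! Suc t) \<in> \<sigma>)"
    then show "(stake t h, h !! t) \<in> \<sigma>"
      by (cases t) (simp_all del: stake.simps(2) snth.simps(2))
  next
    assume all: "\<forall>t. (stake t h, h !! t) \<in> \<sigma>"
    then show "([], h !! 0) \<in> \<sigma> \<and> (\<forall>t. (stake (Suc t) h, h !! Suc t) \<in> \<sigma>)"
      using all[rule_format, of 0] by (simp del: stake.simps(2) snth.simps)
  qed
  then show ?thesis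
    by (simp add: outcomes_def)
qed

text \<open>Obeying \<sigma> at time \<open>t\<close> is a condition on the first
  \<open>t + 1\<close> letters only, so it passes from outcomes to any word whose prefixes are all
  prefixes of outcomes.\<close>

lemma closedin_outcomes:
  "closedin (Metric_space.mtopology (streams A) word_dist) (outcomes A \<sigma>)"
proof -
  have "(stake t x, x !! t) \<in> \<sigma>" if "\<forall>k. stake k x \<in> \<Union> (Pref ` outcomes A \<sigma>)" for x t
  proof -
    \<comment> \<open>Length \<open>Suc t\<close> is what captures both the history
      \<open>stake t x\<close> and the move \<open>x !! t\<close> answering it. The outcome
      \<open>y\<close> may vary with \<open>t\<close>.\<close>
    from that have "stake (Suc t) x \<in> \<Union> (Pref ` outcomes A \<sigma>)" ..
    then obtain y where y: "y \<in> outcomes A \<sigma>" "stake (Suc t) x \<in> Pref y"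
      by blast
    then have eq: "stake (Suc t) x = stake (Suc t) y"
      by (simp only: stake_in_Pref_iff)
    have "stake t x = stake t y" "x !! t = y !! t"
      using eq by (simp_all add: stake_Suc del: stake.simps)
    then show ?thesis
      using y by (simp add: outcomes_iff)
  qed
  moreover have "outcomes A \<sigma> \<subseteq> streams A"
    by (auto simp: outcomes_iff)
  ultimately show ?thesis
    by (simp add: closedin_word_dist_iff outcomes_iff)
qed

theorem corollary5p3:
  fixes n :: nat and Act :: "nat \<Rightarrow> 'a set" and L :: "(nat \<Rightarrow> 'a) stream set"
  assumes "1 \<le> n"
    and "L \<subseteq> streams (moves n Act)"
  shows "strategical n Act L \<longleftrightarrow>
    closedin (Metric_space.mtopology (streams (moves n Act)) word_dist) L"
proof
  assume "strategical n Act L"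
  then show "closedin (Metric_space.mtopology (streams (moves n Act)) word_dist) L"
    unfolding strategical_def by (auto simp: closedin_outcomes)
next
  let ?A = "moves n Act"
  assume closed: "closedin (Metric_space.mtopology (streams ?A) word_dist) L"
  define P where "P = lists ?A \<inter> \<Union> (Pref ` L)"
  have "P \<times> ?A \<in> strategy_vectors n Act"
    unfolding strategy_vectors_def mem_Collect_eq
  proof (intro conjI exI[where x = "\<lambda>i. P \<times> Act i"] ballI)
    show "P \<times> ?A \<subseteq> lists ?A \<times> ?A"
      by (auto simp: P_def)
    show "P \<times> Act i \<in> strategies n Act i" for i
      by (auto simp: P_def strategies_def)
    fix w a assume "a \<in> ?A"
    then have "a i \<in> Act i" if "i \<in> {1..n}" for i
      using that by (auto simp: moves_def)
    \<comment> \<open>For \<open>w\<close> outside \<open>P\<close> the right-hand side must fail: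
      player 1 has no allowed action there, whereas without players it would hold vacuously.\<close>
    moreover have "1 \<in> {1..n}"
      using assms(1) by simp
    ultimately show "a \<in> (P \<times> ?A) `` {w} \<longleftrightarrow> (\<forall>i\<in>{1..n}. a i \<in> (P \<times> Act i) `` {w})"
      using \<open>a \<in> ?A\<close> by blast
  qed
  moreover have "L = outcomes ?A (P \<times> ?A)"
  proof -
    have in_P: "stake k h \<in> P \<longleftrightarrow> stake k h \<in> \<Union> (Pref ` L)" if "h \<in> streams ?A" for h k
      using that by (auto simp: P_def streams_iff_snth in_set_conv_nth)
    \<comment> \<open>Each letter of \<open>h\<close> is a move, so the only constraint left is that
      every history lies in \<open>P\<close>.\<close>
    have "h \<in> outcomes ?A (P \<times> ?A) \<longleftrightarrow>
        h \<in> streams ?A \<and> (\<forall>k. stake k h \<in> \<Union> (Pref ` L))" for h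
      by (auto simp: outcomes_iff in_P streams_iff_snth simp del: UN_iff)
    \<comment> \<open>This gives the inclusion of \<open>L\<close> in the outcomes; the converse is
      where closedness enters.\<close>
    moreover have "stake k h \<in> \<Union> (Pref ` L)" if "h \<in> L" for h k
      using that by (auto simp: Pref_def)
    ultimately show ?thesis
      using closed assms(2) closedin_word_dist_iff[OF assms(2)] by blast
  qed
  ultimately show "strategical n Act L"
    unfolding strategical_def by blast
qed

end
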